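(* Let $E,F$ be Banach spaces, let $A_0\in B(E,F)$ be double-split with generalized inverse $A_0^{+}$, and assume that $\dim N(A_0)$ and $\dim N(A_0^{+})$ are positive (possibly infinite). Let $\mathcal F=\{\mathbf M(X)\}_{X\in B(E,F)}$ and $$\mathbf E_*=\left\{P_{N(A_0^+)}^{R(A_0)}\,T\,P_{N(A_0)}^{R(A_0^+)}: T\in B(E,F)\right\}.$$ Then the co-tailed set $J(A_0,\mathbf E_* )$ of $\mathcal F$ at $A_0$ is non-trivial, i.e. $A_0$ is not an inner point of $J(A_0,\mathbf E_* )$.
   Context: $B(E,F)$ is the Banach space of bounded linear operators from $E$ to $F$; $R(\cdot)$ and $N(\cdot)$ denote range and null space. $A\in B(E,F)$ is double-split if $R(A)$ is closed and both $N(A)$ and $R(A)$ have closed complements in $E$ and $F$; equivalently, $A$ has a generalized inverse, i.e. an operator $A^{+}\in B(F,E)$ with $A^{+}AA^{+}=A^{+}$ and $AA^{+}A=A$. Then $E=N(A)\oplus R(A^{+})$ and $F=R(A)\oplus N(A^{+})$. $P_M^{N}$ denotes the projection onto $M$ along $N$. $\mathbf M(X)=\{T\in B(E,F):TN(X)\subset R(X)\}$ for $X\in B(E,F)$. One has $\mathbf M(A_0)\oplus\mathbf E_*=B(E,F)$ (direct sum of closed subspaces), and the co-tailed set of $\mathcal F$ at $A_0$ is $$J(A_0,\mathbf E_* )=\{X\in B(E,F):\mathbf M(X)\oplus\mathbf E_*=B(E,F)\}.$$ It is called trivial if $A_0$ is an inner point of it, and non-trivial otherwise. *)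

theory Defs
  imports "HOL-Analysis.Analysis"
begin

text \<open>Bounded operators \<open>E \<rightarrow> F\<close> are the type \<open>'e \<Rightarrow>\<^sub>L 'f\<close> with the operator norm.\<close>

definition null_space :: "('e::real_normed_vector \<Rightarrow>\<^sub>L 'f::real_normed_vector) \<Rightarrow> 'e set"
  where "null_space A = {x. blinfun_apply A x = 0}"

definition range_space :: "('e::real_normed_vector \<Rightarrow>\<^sub>L 'f::real_normed_vector) \<Rightarrow> 'f set"
  where "range_space A = range (blinfun_apply A)"

text \<open>The whole space is the direct sum of the closed subspaces \<open>M\<close> and \<open>N\<close>.\<close>

definition closed_direct_sum :: "'a::real_normed_vector set \<Rightarrow> 'a set \<Rightarrow> bool"
  where "closed_direct_sum M N \<longleftrightarrow>
    subspace M \<and> closed M \<and> subspace N \<and> closed N \<and>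
    M \<inter> N = {0} \<and> {x + y | x y. x \<in> M \<and> y \<in> N} = UNIV"

definition double_split :: "('e::banach \<Rightarrow>\<^sub>L 'f::banach) \<Rightarrow> bool"
  where "double_split A \<longleftrightarrow> closed (range_space A) \<and>
    (\<exists>M. closed_direct_sum (null_space A) M) \<and>
    (\<exists>N. closed_direct_sum (range_space A) N)"

definition generalized_inverse ::
    "('e::real_normed_vector \<Rightarrow>\<^sub>L 'f::real_normed_vector) \<Rightarrow> ('f \<Rightarrow>\<^sub>L 'e) \<Rightarrow> bool"
  where "generalized_inverse A B \<longleftrightarrow>
    B o\<^sub>L A o\<^sub>L B = B \<and> A o\<^sub>L B o\<^sub>L A = A"

text \<open>The projection onto \<open>M\<close> along \<open>N\<close>. It is unique, and on a Banach space it exists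
  whenever \<open>closed_direct_sum M N\<close>; otherwise the value is unspecified.\<close>

definition proj_along :: "'a::real_normed_vector set \<Rightarrow> 'a set \<Rightarrow> ('a \<Rightarrow>\<^sub>L 'a)"
  where "proj_along M N =
    (THE P. P o\<^sub>L P = P \<and> range_space P = M \<and> null_space P = N)"

text \<open>Positive, possibly infinite, dimension: the subspace has a nonempty (Hamel) basis. The
  natural-number-valued \<open>dim\<close> is unsuitable because it is \<open>0\<close> on infinite-dimensional subspaces.\<close>

definition positive_dim :: "'a::real_vector set \<Rightarrow> bool"
  where "positive_dim S \<longleftrightarrow> (\<exists>B. independent B \<and> span B = S \<and> B \<noteq> {})"

definition M_family :: "('e::real_normed_vector \<Rightarrow>\<^sub>L 'f::real_normed_vector) \<Rightarrow> ('e \<Rightarrow>\<^sub>L 'f) set"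
  where "M_family X = {T. blinfun_apply T ` null_space X \<subseteq> range_space X}"

definition E_star ::
    "('e::real_normed_vector \<Rightarrow>\<^sub>L 'f::real_normed_vector) \<Rightarrow> ('f \<Rightarrow>\<^sub>L 'e) \<Rightarrow> ('e \<Rightarrow>\<^sub>L 'f) set"
  where "E_star A B =
    {proj_along (null_space B) (range_space A) o\<^sub>L T o\<^sub>L
       proj_along (null_space A) (range_space B) | T. True}"

text \<open>The co-tailed set of a family of subspaces, for a complement \<open>C\<close> of the member at the base
  point \<open>x0\<close>. The set depends on \<open>x0\<close> only through \<open>C\<close>.\<close>

definition cotailed_set ::
    "('x \<Rightarrow> 'b::real_normed_vector set) \<Rightarrow> 'b set \<Rightarrow> 'x set"
  where "cotailed_set \<F> C = {x. closed_direct_sum (\<F> x) C}"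

definition cotailed_trivial ::
    "('x::topological_space \<Rightarrow> 'b::real_normed_vector set) \<Rightarrow> 'x \<Rightarrow> 'b set \<Rightarrow> bool"
  where "cotailed_trivial \<F> x0 C \<longleftrightarrow> x0 \<in> interior (cotailed_set \<F> C)"

end

theory Submission
  imports Defs
begin

text \<open>The pencil \<open>A\<^sub>0 + t S\<close> with a suitable rank-one operator \<open>S\<close> passes through \<open>A\<^sub>0\<close> and leaves
  the co-tailed set immediately. Choose \<open>u \<noteq> 0\<close> in \<open>N(A\<^sub>0)\<close>, \<open>v \<noteq> 0\<close> in \<open>N(A\<^sub>0\<^sup>+)\<close> and a bounded
  functional \<open>f\<close> with \<open>f u \<noteq> 0\<close>, and put \<open>S x = f (P x) v\<close>, where \<open>P = I - A\<^sub>0\<^sup>+ A\<^sub>0\<close> is the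
  projection onto \<open>N(A\<^sub>0)\<close> along \<open>R(A\<^sub>0\<^sup>+)\<close>. Then \<open>S\<close> is a nonzero element of \<open>\<^bold>E\<^sub>*\<close>. Since
  \<open>R(A\<^sub>0)\<close> and \<open>N(A\<^sub>0\<^sup>+)\<close> meet only in \<open>0\<close>, for \<open>t \<noteq> 0\<close> the equation \<open>(A\<^sub>0 + t S) x = 0\<close> splits
  into \<open>A\<^sub>0 x = 0\<close> and \<open>S x = 0\<close>. Hence \<open>S\<close> annihilates \<open>N(A\<^sub>0 + t S)\<close>, so that \<open>S\<close> also lies in
  \<open>\<^bold>M(A\<^sub>0 + t S)\<close>, and the sum of \<open>\<^bold>M(A\<^sub>0 + t S)\<close> and \<open>\<^bold>E\<^sub>*\<close> is not direct, however small \<open>t\<close> is.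

  The functional \<open>f\<close> is an instance of the Hahn--Banach theorem, which is indispensable: were there no
  nonzero functionals, \<open>\<^bold>E\<^sub>*\<close> could be zero. It is proved here by the observation that a pointwise
  minimal sublinear functional is linear (lemma \<open>minimal_sublinear_imp_linear\<close>); Zorn's lemma
  provides such a functional below any given one.\<close>

section \<open>Norming functionals\<close>

definition sublinear :: "('a::real_vector \<Rightarrow> real) \<Rightarrow> bool"
  where "sublinear p \<longleftrightarrow>
    (\<forall>x y. p (x + y) \<le> p x + p y) \<and> (\<forall>c x. 0 \<le> c \<longrightarrow> p (c *\<^sub>R x) \<le> c * p x)"

lemma sublinearI:
  assumes "\<And>x y. p (x + y) \<le> p x + p y" "\<And>c x. 0 < c \<Longrightarrow> p (c *\<^sub>R x) \<le> c * p x" "p 0 \<le> 0"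
  shows "sublinear p"
  unfolding sublinear_def
proof (intro conjI allI impI)
  fix c :: real and x assume "0 \<le> c"
  then show "p (c *\<^sub>R x) \<le> c * p x"
    using assms(2,3) by (cases "c = 0") auto
qed (rule assms(1))

lemma sublinear_add: "sublinear p \<Longrightarrow> p (x + y) \<le> p x + p y"
  by (simp add: sublinear_def)

lemma sublinear_scaleR_le: "sublinear p \<Longrightarrow> 0 \<le> c \<Longrightarrow> p (c *\<^sub>R x) \<le> c * p x"
  by (simp add: sublinear_def)

lemma sublinear_zero: "sublinear p \<Longrightarrow> p 0 = 0"
  using sublinear_add[of p 0 0] sublinear_scaleR_le[of p 0 0] by simp

lemma sublinear_scaleR:
  assumes "sublinear p" "0 \<le> c"
  shows "p (c *\<^sub>R x) = c * p x"
proof (cases "c = 0")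
  case False
  then have "p x \<le> inverse c * p (c *\<^sub>R x)"
    using sublinear_scaleR_le[OF assms(1), of "inverse c" "c *\<^sub>R x"] assms(2) by simp
  then have "c * p x \<le> c * (inverse c * p (c *\<^sub>R x))"
    using assms(2) by (rule mult_left_mono)
  then show ?thesis
    using sublinear_scaleR_le[OF assms, of x] False by (simp flip: mult.assoc)
qed (simp add: sublinear_zero[OF assms(1)])

lemma sublinear_neg_le:
  assumes "sublinear p"
  shows "- p (- x) \<le> p x"
  using sublinear_add[OF assms, of x "- x"] sublinear_zero[OF assms] by simp

lemma sublinear_norm: "sublinear (norm :: 'a::real_normed_vector \<Rightarrow> real)"
  by (simp add: sublinear_def norm_triangle_ineq)

text \<open>The value at \<open>- y\<close> is lowered to \<open>- p y\<close>, the smallest value there of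
  any sublinear functional below \<open>p\<close>. This modification drives both the extraction of a linear
  functional and the choice of its value at a prescribed vector.\<close>

definition tilt :: "('a::real_vector \<Rightarrow> real) \<Rightarrow> 'a \<Rightarrow> 'a \<Rightarrow> real"
  where "tilt p y x = (INF t\<in>{0..}. p (x + t *\<^sub>R y) - t * p y)"

lemma tilt_le:
  assumes "sublinear p" "0 \<le> t"
  shows "tilt p y x \<le> p (x + t *\<^sub>R y) - t * p y"
  unfolding tilt_def
proof (rule cINF_lower)
  have "- p (- x) \<le> p (x + s *\<^sub>R y) - s * p y" if "0 \<le> s" for s
    using sublinear_add[OF assms(1), of "- x" "x + s *\<^sub>R y"] sublinear_scaleR[OF assms(1) that, of y]
    by simp
  then show "bdd_below ((\<lambda>t. p (x + t *\<^sub>R y) - t * p y) ` {0..})"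
    by (intro bdd_belowI2) auto
qed (use assms in simp)

lemma le_tiltI:
  assumes "\<And>t. 0 \<le> t \<Longrightarrow> m \<le> p (x + t *\<^sub>R y) - t * p y"
  shows "m \<le> tilt p y x"
  unfolding tilt_def using assms by (intro cINF_greatest) auto

lemma tilt_le_self: "sublinear p \<Longrightarrow> tilt p y x \<le> p x"
  using tilt_le[of p 0 y x] by simp

lemma tilt_uminus_le: "sublinear p \<Longrightarrow> tilt p y (- y) \<le> - p y"
  using tilt_le[of p 1 y "- y"] by (simp add: sublinear_zero)

lemma sublinear_tilt:
  assumes p: "sublinear p"
  shows "sublinear (tilt p y)"
proof (rule sublinearI)
  fix x z
  have *: "tilt p y (x + z) - (p (x + s *\<^sub>R y) - s * p y) \<le> p (z + t *\<^sub>R y) - t * p y"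
    if "0 \<le> s" "0 \<le> t" for s t
  proof -
    have "tilt p y (x + z) \<le> p ((x + s *\<^sub>R y) + (z + t *\<^sub>R y)) - (s + t) * p y"
      using tilt_le[OF p, of "s + t" y "x + z"] that by (simp add: algebra_simps)
    also have "\<dots> \<le> p (x + s *\<^sub>R y) + p (z + t *\<^sub>R y) - (s + t) * p y"
      using sublinear_add[OF p] by simp
    finally show ?thesis
      by (simp add: algebra_simps)
  qed
  have "tilt p y (x + z) - tilt p y z \<le> p (x + s *\<^sub>R y) - s * p y" if "0 \<le> s" for s
    using le_tiltI[OF *[OF that]] by (simp add: algebra_simps)
  from le_tiltI[OF this] show "tilt p y (x + z) \<le> tilt p y x + tilt p y z"
    by simp
next
  fix c :: real and x assume c: "0 < c"
  have "tilt p y (c *\<^sub>R x) / c \<le> p (x + t *\<^sub>R y) - t * p y" if "0 \<le> t" for t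
  proof -
    have "tilt p y (c *\<^sub>R x) \<le> p (c *\<^sub>R (x + t *\<^sub>R y)) - (c * t) * p y"
      using tilt_le[OF p, of "c * t" y "c *\<^sub>R x"] that c by (simp add: algebra_simps)
    also have "\<dots> = c * (p (x + t *\<^sub>R y) - t * p y)"
      using sublinear_scaleR[OF p, of c "x + t *\<^sub>R y"] c by (simp add: right_diff_distrib)
    finally show ?thesis
      using c by (simp add: field_simps)
  qed
  from le_tiltI[OF this] show "tilt p y (c *\<^sub>R x) \<le> c * tilt p y x"
    using c by (simp add: field_simps)
next
  show "tilt p y 0 \<le> 0"
    using tilt_le_self[OF p, of y 0] sublinear_zero[OF p] by simp
qed

text \<open>Minimality forces \<open>tilt q y = q\<close>, and evaluating this at \<open>- y\<close> shows that \<open>q\<close> is odd.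
  Oddness turns subadditivity and positive homogeneity into equalities.\<close>

lemma minimal_sublinear_imp_linear:
  assumes q: "sublinear q"
    and minimal: "\<And>r. sublinear r \<Longrightarrow> (\<And>x. r x \<le> q x) \<Longrightarrow> r = q"
  shows "linear q"
proof -
  have odd: "q (- y) = - q y" for y
  proof -
    have "tilt q y = q"
      by (rule minimal) (simp_all add: sublinear_tilt tilt_le_self q)
    then show ?thesis
      using tilt_uminus_le[OF q, of y] sublinear_neg_le[OF q, of y] by simp
  qed
  show ?thesis
  proof (rule linearI)
    fix x y
    have "q x \<le> q (x + y) + q (- y)"
      using sublinear_add[OF q, of "x + y" "- y"] by simp
    then show "q (x + y) = q x + q y"
      using sublinear_add[OF q, of x y] odd[of y] by simp
  next
    fix c :: real and x
    show "q (c *\<^sub>R x) = c *\<^sub>R q x"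
    proof (cases "0 \<le> c")
      case False
      then have "q ((- c) *\<^sub>R x) = - c * q x"
        by (intro sublinear_scaleR[OF q]) simp
      then show ?thesis
        using odd[of "c *\<^sub>R x"] by simp
    qed (simp add: sublinear_scaleR[OF q])
  qed
qed

text \<open>A chain of sublinear functionals below \<open>p\<close> is bounded below pointwise by \<open>- p (- x)\<close>, and its
  pointwise infimum is sublinear because any two members of the chain are comparable.\<close>

lemma ex_sublinear_lower_bound_chain:
  assumes "C \<noteq> {}"
    and sub: "\<And>q. q \<in> C \<Longrightarrow> sublinear q"
    and le: "\<And>q x. q \<in> C \<Longrightarrow> q x \<le> p x"
    and chain: "\<And>q r. q \<in> C \<Longrightarrow> r \<in> C \<Longrightarrow> q \<le> r \<or> r \<le> q"
  shows "\<exists>m. sublinear m \<and> (\<forall>q\<in>C. m \<le> q)"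
proof -
  define m where "m x = (INF q\<in>C. q x)" for x
  have lower: "m x \<le> q x" if "q \<in> C" for q x
    unfolding m_def
  proof (rule cINF_lower)
    show "bdd_below ((\<lambda>q. q x) ` C)"
      using sublinear_neg_le[OF sub] le[of _ "- x"]
      by (intro bdd_belowI2[of _ "- p (- x)"]) (smt (verit))
  qed (rule that)
  have greatest: "b \<le> m x" if "\<And>q. q \<in> C \<Longrightarrow> b \<le> q x" for b x
    unfolding m_def using assms(1) that by (rule cINF_greatest)
  have "sublinear m"
  proof (rule sublinearI)
    fix x y
    have *: "m (x + y) - q x \<le> r y" if "q \<in> C" "r \<in> C" for q r
    proof -
      have "m (x + y) \<le> q x + q y" "m (x + y) \<le> r x + r y"
        using lower[OF that(1), of "x + y"] sublinear_add[OF sub[OF that(1)], of x y]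
          lower[OF that(2), of "x + y"] sublinear_add[OF sub[OF that(2)], of x y] by linarith+
      with chain[OF that] show ?thesis
        by (auto simp: le_fun_def) (smt (verit))+
    qed
    have "m (x + y) - m y \<le> q x" if "q \<in> C" for q
      using greatest[of "m (x + y) - q x" y] *[OF that] by simp
    then have "m (x + y) - m y \<le> m x"
      by (rule greatest)
    then show "m (x + y) \<le> m x + m y"
      by simp
  next
    fix c :: real and x assume c: "0 < c"
    have "m (c *\<^sub>R x) / c \<le> q x" if "q \<in> C" for q
      using lower[OF that, of "c *\<^sub>R x"] sublinear_scaleR[OF sub[OF that], of c x] c
      by (simp add: field_simps)
    then have "m (c *\<^sub>R x) / c \<le> m x"
      by (rule greatest)
    then show "m (c *\<^sub>R x) \<le> c * m x"
      using c by (simp add: field_simps)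
  next
    obtain q where "q \<in> C"
      using assms(1) by blast
    then show "m 0 \<le> 0"
      using lower[of q 0] sublinear_zero[OF sub[of q]] by simp
  qed
  then show ?thesis
    using lower by (auto simp: le_fun_def)
qed

lemma ex_linear_below_sublinear:
  assumes p: "sublinear p"
  shows "\<exists>f. linear f \<and> (\<forall>x. f x \<le> p x)"
proof -
  define A where "A = {q. sublinear q \<and> q \<le> p}"
  have "\<exists>m\<in>A. \<forall>q\<in>A. m \<ge> q \<longrightarrow> q = m"
  proof (rule predicate_Zorn)
    show "partial_order_on A (relation_of (\<ge>) A)"
      by (rule partial_order_on_relation_ofI) auto
  next
    fix C assume "C \<in> Chains (relation_of (\<ge>) A)"
    then have C: "C \<subseteq> A" and chain: "\<And>q r. q \<in> C \<Longrightarrow> r \<in> C \<Longrightarrow> q \<le> r \<or> r \<le> q"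
      by (auto simp: Chains_def relation_of_def)
    show "\<exists>u\<in>A. \<forall>q\<in>C. q \<ge> u"
    proof (cases "C = {}")
      case True
      then show ?thesis
        using p by (auto simp: A_def)
    next
      case False
      have "\<exists>m. sublinear m \<and> (\<forall>q\<in>C. m \<le> q)"
        by (rule ex_sublinear_lower_bound_chain[OF False _ _ chain, where p = p])
          (use C in \<open>auto simp: A_def le_fun_def\<close>)
      then obtain m where m: "sublinear m" "\<And>q. q \<in> C \<Longrightarrow> m \<le> q"
        by blast
      with False C have "m \<le> p"
        unfolding A_def by (blast intro: order_trans)
      with m show ?thesis
        by (auto simp: A_def)
    qed
  qed
  then obtain m where m: "sublinear m" "m \<le> p" and min: "\<And>q. q \<in> A \<Longrightarrow> q \<le> m \<Longrightarrow> q = m"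
    by (auto simp: A_def)
  have "linear m"
  proof (rule minimal_sublinear_imp_linear[OF m(1)])
    fix r assume "sublinear r" "\<And>x. r x \<le> m x"
    then have "r \<le> m" "r \<in> A"
      using m(2) by (auto simp: A_def le_fun_def intro: order_trans)
    then show "r = m"
      by (intro min)
  qed
  with m(2) show ?thesis
    by (auto simp: le_fun_def)
qed

text \<open>A linear functional below the tilted norm satisfies \<open>f (- u) \<le> - norm u\<close>, besides being
  dominated by the norm.\<close>

lemma ex_norming_functional:
  fixes u :: "'a::real_normed_vector"
  shows "\<exists>f :: 'a \<Rightarrow>\<^sub>L real. (\<forall>x. \<bar>f x\<bar> \<le> norm x) \<and> f u = norm u"
proof -
  obtain g where g: "linear g" and g_le: "\<And>x. g x \<le> tilt norm u x"
    using ex_linear_below_sublinear[OF sublinear_tilt[OF sublinear_norm], of u] by blast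
  have le: "g x \<le> norm x" for x
    using g_le[of x] tilt_le_self[OF sublinear_norm, of u x] by linarith
  have abs: "\<bar>g x\<bar> \<le> norm x" for x
    using le[of x] le[of "- x"] linear_neg[OF g, of x] by simp
  have "norm u \<le> g u"
    using g_le[of "- u"] tilt_uminus_le[OF sublinear_norm, of u] linear_neg[OF g, of u] by simp
  then have "g u = norm u"
    using le[of u] by simp
  moreover have "bounded_linear g"
    using g abs by (intro bounded_linear.intro bounded_linear_axioms.intro exI[of _ 1]) auto
  ultimately show ?thesis
    using abs by (intro exI[of _ "Blinfun g"]) (simp add: bounded_linear_Blinfun_apply)
qed

section \<open>Projections of a generalized inverse\<close>

lemma proj_along_eqI:
  fixes P :: "'a::real_normed_vector \<Rightarrow>\<^sub>L 'a"
  assumes "P o\<^sub>L P = P" "range_space P = M" "null_space P = N"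
  shows "proj_along M N = P"
  unfolding proj_along_def
proof (rule the_equality)
  fix Q assume Q: "Q o\<^sub>L Q = Q \<and> range_space Q = M \<and> null_space Q = N"
  show "Q = P"
  proof (rule blinfun_eqI)
    fix x
    have "P (P x) = P x"
      by (metis assms(1) blinfun_apply_blinfun_compose)
    then have "x - P x \<in> null_space P"
      by (simp add: null_space_def blinfun.diff_right)
    then have "Q (x - P x) = 0"
      using Q assms(3) by (auto simp: null_space_def)
    moreover have "P x \<in> range_space Q"
      using Q assms(2) by (auto simp: range_space_def)
    then have "Q (P x) = P x"
      using Q by (auto simp: range_space_def) (metis blinfun_apply_blinfun_compose)
    ultimately show "Q x = P x"
      by (simp add: blinfun.diff_right)
  qed
qed (use assms in auto)

lemma generalized_inverse_sym: "generalized_inverse A B \<Longrightarrow> generalized_inverse B A"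
  by (simp add: generalized_inverse_def)

lemma generalized_inverse_apply:
  fixes A :: "'e::real_normed_vector \<Rightarrow>\<^sub>L 'f::real_normed_vector" and B :: "'f \<Rightarrow>\<^sub>L 'e"
  assumes "generalized_inverse A B"
  shows "A (B (A x)) = A x"
  using assms unfolding generalized_inverse_def by (metis blinfun_apply_blinfun_compose)

lemma proj_along_null_range:
  fixes A :: "'e::real_normed_vector \<Rightarrow>\<^sub>L 'f::real_normed_vector" and B :: "'f \<Rightarrow>\<^sub>L 'e"
  assumes "generalized_inverse A B"
  shows "proj_along (null_space A) (range_space B) = id_blinfun - (B o\<^sub>L A)"
proof (rule proj_along_eqI)
  have ABA: "A (B (A x)) = A x" and BAB: "B (A (B y)) = B y" for x y
    using generalized_inverse_apply[OF assms]
      generalized_inverse_apply[OF generalized_inverse_sym[OF assms]] by auto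
  show "(id_blinfun - (B o\<^sub>L A)) o\<^sub>L (id_blinfun - (B o\<^sub>L A)) = id_blinfun - (B o\<^sub>L A)"
    by (rule blinfun_eqI) (simp add: blinfun.diff_left blinfun.diff_right ABA)
  show "range_space (id_blinfun - (B o\<^sub>L A)) = null_space A"
  proof (intro subset_antisym subsetI)
    fix x assume "x \<in> null_space A"
    then have "x = (id_blinfun - (B o\<^sub>L A)) x"
      by (simp add: null_space_def blinfun.diff_left)
    then show "x \<in> range_space (id_blinfun - (B o\<^sub>L A))"
      unfolding range_space_def by (rule range_eqI)
  qed (auto simp: range_space_def null_space_def blinfun.diff_left blinfun.diff_right ABA)
  show "null_space (id_blinfun - (B o\<^sub>L A)) = range_space B"
    by (auto simp: range_space_def null_space_def blinfun.diff_left BAB)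
qed

text \<open>The operators of \<open>\<^bold>E\<^sub>*\<close> are those that vanish on \<open>R(A\<^sup>+)\<close> and take values in \<open>N(A\<^sup>+)\<close>:
  such an operator is unchanged when it is composed with the two projections.\<close>

lemma E_starI:
  fixes A :: "'e::real_normed_vector \<Rightarrow>\<^sub>L 'f::real_normed_vector" and B :: "'f \<Rightarrow>\<^sub>L 'e"
    and S :: "'e \<Rightarrow>\<^sub>L 'f"
  assumes "generalized_inverse A B" "\<And>y. S (B y) = 0" "\<And>x. B (S x) = 0"
  shows "S \<in> E_star A B"
proof -
  have "S = proj_along (null_space B) (range_space A) o\<^sub>L S o\<^sub>L
      proj_along (null_space A) (range_space B)"
    unfolding proj_along_null_range[OF assms(1)]
      proj_along_null_range[OF generalized_inverse_sym[OF assms(1)]]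
    by (rule blinfun_eqI) (simp add: blinfun.diff_left blinfun.diff_right assms)
  then show ?thesis
    unfolding E_star_def by blast
qed

section \<open>Perturbations that leave the co-tailed set\<close>

lemma positive_dim_obtain_nonzero:
  assumes "positive_dim S"
  obtains x where "x \<in> S" "x \<noteq> 0"
proof -
  obtain B b where "independent B" "span B = S" "b \<in> B"
    using assms by (auto simp: positive_dim_def)
  then show thesis
    using that dependent_zero span_base by blast
qed

text \<open>A nonzero rank-one map from \<open>N(A)\<close> to \<open>N(A\<^sup>+)\<close>, extended by zero on \<open>R(A\<^sup>+)\<close>. The
  norming functional prevents the extension from vanishing at \<open>u\<close>.\<close>

lemma obtain_nonzero_killed_by_generalized_inverse:
  fixes A :: "'e::real_normed_vector \<Rightarrow>\<^sub>L 'f::real_normed_vector" and B :: "'f \<Rightarrow>\<^sub>L 'e"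
  assumes AB: "generalized_inverse A B"
    and "u \<in> null_space A" "u \<noteq> 0" "v \<in> null_space B" "v \<noteq> 0"
  obtains S :: "'e \<Rightarrow>\<^sub>L 'f" where "S \<noteq> 0" "\<And>y. S (B y) = 0" "\<And>x. B (S x) = 0"
proof -
  obtain f :: "'e \<Rightarrow>\<^sub>L real" where f: "f u = norm u"
    using ex_norming_functional by blast
  define S where "S = blinfun_scaleR_left v o\<^sub>L f o\<^sub>L (id_blinfun - (B o\<^sub>L A))"
  have S: "S x = f (x - B (A x)) *\<^sub>R v" for x
    by (simp add: S_def blinfun.diff_left)
  have "S u = norm u *\<^sub>R v"
    using assms(2) f by (simp add: S null_space_def)
  then have "S \<noteq> 0"
    using assms(3,5) by auto
  moreover have "S (B y) = 0" for y
    using generalized_inverse_apply[OF generalized_inverse_sym[OF AB], of y] by (simp add: S)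
  moreover have "B (S x) = 0" for x
    using assms(4) by (simp add: S null_space_def blinfun.scaleR_right)
  ultimately show thesis
    by (rule that)
qed

text \<open>Applying \<open>A\<^sup>+\<close> and then \<open>A\<close> to \<open>(A + t S) x = 0\<close> isolates the component \<open>A x\<close>, because \<open>A\<^sup>+ S = 0\<close>.
  So \<open>S\<close> kills \<open>N(A + t S)\<close>, which makes the tail condition defining \<open>\<^bold>M(A + t S)\<close> trivial.\<close>

lemma perturbation_in_M_family:
  fixes A :: "'e::real_normed_vector \<Rightarrow>\<^sub>L 'f::real_normed_vector" and B :: "'f \<Rightarrow>\<^sub>L 'e"
    and S :: "'e \<Rightarrow>\<^sub>L 'f"
  assumes AB: "generalized_inverse A B" and BS: "\<And>x. B (S x) = 0" and t: "t \<noteq> 0"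
  shows "S \<in> M_family (A + t *\<^sub>R S)"
proof -
  have "S x = 0" if "x \<in> null_space (A + t *\<^sub>R S)" for x
  proof -
    have *: "A x + t *\<^sub>R S x = 0"
      using that by (simp add: null_space_def blinfun.add_left blinfun.scaleR_left)
    then have "B (A x + t *\<^sub>R S x) = 0"
      by simp
    then have "B (A x) = 0"
      by (simp add: blinfun.add_right blinfun.scaleR_right BS)
    then have "A x = 0"
      using generalized_inverse_apply[OF AB, of x] by simp
    then show ?thesis
      using * t by simp
  qed
  moreover have "0 \<in> range_space (A + t *\<^sub>R S)"
    unfolding range_space_def by (rule range_eqI[of _ _ 0]) simp
  ultimately show ?thesis
    by (auto simp: M_family_def)
qed

lemma perturbation_not_in_cotailed_set:
  fixes A :: "'e::real_normed_vector \<Rightarrow>\<^sub>L 'f::real_normed_vector" and B :: "'f \<Rightarrow>\<^sub>L 'e"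
    and S :: "'e \<Rightarrow>\<^sub>L 'f"
  assumes "generalized_inverse A B" "S \<noteq> 0" "\<And>y. S (B y) = 0" "\<And>x. B (S x) = 0" "t \<noteq> 0"
  shows "A + t *\<^sub>R S \<notin> cotailed_set M_family (E_star A B)"
proof
  assume "A + t *\<^sub>R S \<in> cotailed_set M_family (E_star A B)"
  then have "M_family (A + t *\<^sub>R S) \<inter> E_star A B = {0}"
    by (simp add: cotailed_set_def closed_direct_sum_def)
  with perturbation_in_M_family[OF assms(1,4,5)] E_starI[OF assms(1,3,4)] assms(2)
  show False
    by blast
qed

theorem theorem4p3:
  fixes A0 :: "'e::banach \<Rightarrow>\<^sub>L 'f::banach" and A0p :: "'f \<Rightarrow>\<^sub>L 'e"
  assumes "double_split A0"
    and "generalized_inverse A0 A0p"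
    and "positive_dim (null_space A0)"
    and "positive_dim (null_space A0p)"
  shows "\<not> cotailed_trivial M_family A0 (E_star A0 A0p)"
proof
  assume "cotailed_trivial M_family A0 (E_star A0 A0p)"
  then have interior: "A0 \<in> interior (cotailed_set M_family (E_star A0 A0p))"
    by (simp add: cotailed_trivial_def)
  obtain u v where "u \<in> null_space A0" "u \<noteq> 0" "v \<in> null_space A0p" "v \<noteq> 0"
    using positive_dim_obtain_nonzero assms(3,4) by metis
  then obtain S :: "'e \<Rightarrow>\<^sub>L 'f" where S: "S \<noteq> 0" "\<And>y. S (A0p y) = 0" "\<And>x. A0p (S x) = 0"
    using obtain_nonzero_killed_by_generalized_inverse[OF assms(2)] by metis
  have "((\<lambda>t. A0 + t *\<^sub>R S) \<longlongrightarrow> A0 + 0 *\<^sub>R S) (at 0)"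
    by (intro tendsto_intros)
  then have "\<forall>\<^sub>F t in at 0. A0 + t *\<^sub>R S \<in> interior (cotailed_set M_family (E_star A0 A0p))"
    using interior by (intro topological_tendstoD[where l = A0]) auto
  moreover have "\<forall>\<^sub>F t in at (0::real). t \<noteq> 0"
    by (rule eventually_neq_at_within)
  ultimately have "\<forall>\<^sub>F t in at (0::real). False"
  proof eventually_elim
    case (elim t)
    then show False
      using perturbation_not_in_cotailed_set[OF assms(2) S] interior_subset by blast
  qed
  then show False
    by simp
qed

end
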